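(* Let $T=(V,E)$ be a tree and let $L$ be the set of its leaves. Then $L$ is a mutual-visibility set of $T$ and $\mu(T)=|L|$.
   Context: Graphs are finite, simple, loopless, undirected and unweighted. A tree is a connected graph without cycles; its leaves are its pendant vertices, that is, the vertices with exactly one neighbor. For a graph $G=(V,E)$ and a set $P\subseteq V$ of points, two points are mutually visible if there is a shortest path between them in $G$ with no further point of $P$. $P$ is a mutual-visibility set of $G$ if its points are pairwise mutually visible. The mutual-visibility number $\mu(G)$ is the size of any largest mutual-visibility set of $G$.
   Formalization: The equality μ(T)=|L| is claimed only for trees with more than one vertex: the one-vertex tree has no leaves (its vertex has no neighbor), but its mutual-visibility number is 1. *)

theory Defs
  imports "Graph_Theory.Digraph_Component"
begin

text \<open>
  A finite simple undirected graph is an instance of \<^locale>\<open>pair_graph\<close>: a finite vertex set with a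
  symmetric irreflexive arc set, an edge \<open>{u, v}\<close> being the pair of arcs \<open>(u, v)\<close> and \<open>(v, u)\<close>.

  The library's \<^const>\<open>tree\<close> must not be used for such graphs: its notion of cycle is the directed
  one, so walking along an edge and back counts as a cycle of length 2. The cycles of the
  undirected graph are those of length at least 3. \<^const>\<open>connected\<close> includes that there is at
  least one vertex.
\<close>

definition undirected_tree :: "'a pair_pre_digraph \<Rightarrow> bool" where
  "undirected_tree G \<longleftrightarrow>
     pair_graph G \<and> connected (with_proj G) \<and>
     \<not> (\<exists>p. pre_digraph.cycle (with_proj G) p \<and> 3 \<le> length p)"

definition leaves :: "'a pair_pre_digraph \<Rightarrow> 'a set" where
  "leaves G = {v \<in> pverts G. \<exists>!w. (v, w) \<in> parcs G}"

text \<open>Walks are lists of arcs, so the length of the list is the length of the walk.\<close>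

definition shortest_path :: "'a pair_pre_digraph \<Rightarrow> 'a \<Rightarrow> ('a \<times> 'a) awalk \<Rightarrow> 'a \<Rightarrow> bool" where
  "shortest_path G u p v \<longleftrightarrow>
     pre_digraph.apath (with_proj G) u p v \<and>
     (\<forall>q. pre_digraph.apath (with_proj G) u q v \<longrightarrow> length p \<le> length q)"

definition mutually_visible :: "'a pair_pre_digraph \<Rightarrow> 'a set \<Rightarrow> 'a \<Rightarrow> 'a \<Rightarrow> bool" where
  "mutually_visible G P u v \<longleftrightarrow>
     (\<exists>p. shortest_path G u p v \<and>
          set (pre_digraph.awalk_verts (with_proj G) u p) \<inter> P \<subseteq> {u, v})"

definition mutual_visibility_set :: "'a pair_pre_digraph \<Rightarrow> 'a set \<Rightarrow> bool" where
  "mutual_visibility_set G P \<longleftrightarrow>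
     P \<subseteq> pverts G \<and> (\<forall>u\<in>P. \<forall>v\<in>P. u \<noteq> v \<longrightarrow> mutually_visible G P u v)"

text \<open>The maximum is well defined for finite graphs, as the empty set is a mutual-visibility set.\<close>

definition mutual_visibility_number :: "'a pair_pre_digraph \<Rightarrow> nat" where
  "mutual_visibility_number G = Max (card ` {P. mutual_visibility_set G P})"

end

theory Submission
  imports Defs
begin

text \<open>
  Paths in a tree are unique, and a path cannot pass through a leaf, so the leaves are pairwise
  visible. Conversely let \<open>P\<close> be a mutual-visibility set with at least two points and let \<open>p \<in> P\<close>.
  Prolonging a path that leads from another point of \<open>P\<close> to \<open>p\<close> as far as possible ends in a leaf
  \<open>f p\<close>. The points of \<open>P\<close> other than \<open>p\<close> see each other along paths avoiding \<open>p\<close>, so \<open>p\<close> separates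
  every one of them from \<open>f p\<close>. If \<open>f p = f q\<close> with \<open>p \<noteq> q\<close>, then \<open>q\<close> lies beyond \<open>p\<close> and \<open>p\<close> beyond
  \<open>q\<close> on the way to this leaf, which is absurd; hence \<open>f\<close> is injective.
\<close>

section \<open>Paths, and their uniqueness in trees\<close>

text \<open>Cutting the cycles out of a walk adds no vertex. A vertex avoided by two consecutive
  walks is thus avoided by some path between their outer ends.\<close>

lemma (in wf_digraph) apath_within_awalk:
  assumes "awalk u p v"
  obtains q where "apath u q v" "set (awalk_verts u q) \<subseteq> set (awalk_verts u p)"
proof
  show q: "apath u (awalk_to_apath p) v"
    using assms by (rule apath_awalk_to_apath)
  show "set (awalk_verts u (awalk_to_apath p)) \<subseteq> set (awalk_verts u p)"
    using awalk_to_apath_subset[OF assms] set_awalk_verts[OF assms]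
      set_awalk_verts[OF awalkI_apath[OF q]] by auto
qed

locale pair_tree = pair_graph +
  assumes connected_tree: "connected (with_proj G)"
    and no_long_cycle: "cycle p \<Longrightarrow> length p < 3"
begin

lemma apath_exists:
  assumes "u \<in> pverts G" "v \<in> pverts G"
  obtains p where "apath u p v"
proof -
  have "strongly_connected (with_proj G)"
    using symmetric_connected_imp_strongly_connected[OF sym_arcs connected_tree] .
  with assms have "u \<rightarrow>\<^sup>*\<^bsub>with_proj G\<^esub> v"
    by (auto simp: strongly_connected_def)
  then show thesis
    using that reachable_apath by auto
qed

text \<open>Induction along the first path. If the two paths left \<open>u\<close> for different
  neighbors, their remainders, joined at \<open>v\<close>, would connect these neighbors without
  \<open>u\<close>, and returning through \<open>u\<close> would close a cycle.\<close>

lemma apath_unique: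
  assumes "apath u p v" "apath u q v"
  shows "p = q"
  using assms
proof (induction p arbitrary: u q)
  case Nil
  then show ?case
    using apath_nonempty_ends[OF Nil.prems(2)] by (auto simp: apath_Nil_iff)
next
  case (Cons e p)
  have "q \<noteq> []"
    using apath_nonempty_ends[OF Cons.prems(1)] Cons.prems(2) by (auto simp: apath_Nil_iff)
  then obtain f q' where q: "q = f # q'"
    by (cases q) auto
  obtain a b where e: "e = (u, a)" and f: "f = (u, b)"
    using Cons.prems q by (cases e; cases f) (auto simp: apath_Cons_iff)
  have arcs: "(u, a) \<in> parcs G" "(u, b) \<in> parcs G"
    and p: "apath a p v" "u \<notin> set (awalk_verts a p)"
    and q': "apath b q' v" "u \<notin> set (awalk_verts b q')"
    using Cons.prems q e f by (auto simp: apath_Cons_iff)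
  have "a = b"
  proof (rule ccontr)
    assume "a \<noteq> b"
    have pw: "awalk a p v" and qw: "awalk v (rev_path q') b"
      using p q' by (auto intro: awalkI_apath)
    have "awalk a (p @ rev_path q') b"
      using awalk_appendI[OF pw qw] .
    then obtain r where r: "apath a r b"
        "set (awalk_verts a r) \<subseteq> set (awalk_verts a (p @ rev_path q'))"
      by (rule apath_within_awalk)
    have "u \<notin> set (awalk_verts a (p @ rev_path q'))"
      using set_awalk_verts_append[OF pw qw] p(2) q' awalk_verts_rev_path[OF awalkI_apath[OF q'(1)]]
      by auto
    with r have u: "u \<notin> set (awalk_verts a r)"
      by auto
    \<comment> \<open>With the two arcs at \<open>u\<close>, a nonempty \<open>r\<close> makes the
      closed walk at least 3 arcs long, which excludes the harmless walk along an edge and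
      back.\<close>
    have "r \<noteq> []"
      using r \<open>a \<noteq> b\<close> by (auto simp: apath_Nil_iff)
    have bu: "awalk b [(b, u)] u"
      using arcs by (auto simp: awalk_simps intro: arcs_symmetric in_arcsD1)
    have walk: "awalk a (r @ [(b, u)]) u"
      using awalk_appendI[OF awalkI_apath[OF r(1)] bu] .
    have "awalk u ((u, a) # r @ [(b, u)]) u"
      using walk arcs by (simp only: awalk_Cons_iff) auto
    moreover have "distinct (awalk_verts a (r @ [(b, u)]))"
      using awalk_verts_append[OF walk] r(1) u by (auto simp: apath_def)
    ultimately have "cycle ((u, a) # r @ [(b, u)])"
      unfolding cycle_def by auto
    from no_long_cycle[OF this] \<open>r \<noteq> []\<close> show False
      by (cases r) auto
  qed
  with Cons.IH p q' q e f show ?case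
    by auto
qed

section \<open>Leaves as ends of paths\<close>

text \<open>Take a longest path from \<open>u\<close> through \<open>v\<close>. A neighbor of its
  end off the path would prolong it, and one on the path must be the last vertex but one.\<close>

lemma leaf_beyond:
  assumes "u \<in> pverts G" "v \<in> pverts G" "u \<noteq> v"
  obtains x p where "x \<in> leaves G" "apath u p x" "v \<in> set (awalk_verts u p)"
proof -
  let ?Q = "\<lambda>p. \<exists>x. apath u p x \<and> v \<in> set (awalk_verts u p)"
  obtain p0 where "apath u p0 v"
    using apath_exists[of u v] assms by blast
  then have "?Q p0"
    by (auto simp: apath_def)
  moreover have "\<forall>p. ?Q p \<longrightarrow> length p < card (pverts G)"
    using length_apath_less by auto
  ultimately have "\<exists>p. ?Q p \<and> (\<forall>q. ?Q q \<longrightarrow> length q \<le> length p)"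
    by (rule Lattices_Big.ex_has_greatest_nat)
  then obtain p where "?Q p" and max: "\<And>q. ?Q q \<Longrightarrow> length q \<le> length p"
    by metis
  then obtain x where p: "apath u p x" and v: "v \<in> set (awalk_verts u p)"
    by auto
  have pw: "awalk u p x"
    using p by (rule awalkI_apath)
  have "p \<noteq> []"
    using v assms by auto
  then obtain p' y x' where p': "p = p' @ [(y, x')]"
    by (cases p rule: rev_cases) auto
  have "x' = x" and yx: "(y, x) \<in> parcs G"
    using pw unfolding p' by (auto simp: awalk_simps)
  have "x \<in> leaves G"
    unfolding leaves_def
  proof (intro CollectI conjI ex1I[of _ y])
    show "x \<in> pverts G" "(x, y) \<in> parcs G"
      using yx by (auto intro: arcs_symmetric in_arcsD2)
    fix z assume xz: "(x, z) \<in> parcs G"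
    then have zx: "(z, x) \<in> parcs G" and "x \<noteq> z"
      by (auto intro: arcs_symmetric dest: no_loops')
    have "z \<in> set (awalk_verts u p)"
    proof (rule ccontr)
      assume z: "z \<notin> set (awalk_verts u p)"
      have "awalk x [(x, z)] z"
        using xz by (auto simp: awalk_simps intro: in_arcsD2)
      then have walk: "awalk u (p @ [(x, z)]) z"
        using pw by (rule awalk_appendI[rotated])
      have "apath u (p @ [(x, z)]) z"
        using walk awalk_verts_append[OF walk] p z by (auto simp: apath_def)
      moreover have "v \<in> set (awalk_verts u (p @ [(x, z)]))"
        using awalk_verts_append[OF walk] v by auto
      ultimately show False
        using max[of "p @ [(x, z)]"] by auto
    qed
    \<comment> \<open>The part of \<open>p\<close> from \<open>z\<close> on and the single arc from
      \<open>z\<close> to \<open>x\<close> are both paths, so they coincide by uniqueness.\<close>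
    from awalk_decomp[OF pw this] obtain q r
      where qr: "p = q @ r" "awalk u q z" "awalk z r x"
      by auto
    then have "apath z r x"
      using p by (auto simp: apath_append_iff)
    moreover have "apath z [(z, x)] x"
      using zx \<open>x \<noteq> z\<close> by (auto simp: apath_simps intro: in_arcsD2)
    ultimately have "r = [(z, x)]"
      by (rule apath_unique)
    with qr p' show "z = y"
      by auto
  qed
  with p v show thesis
    using that by blast
qed

text \<open>An inner vertex of a path has a predecessor and a successor on it, which differ because
  a path repeats no vertex; a leaf has only one neighbor.\<close>

lemma leaf_on_apath:
  assumes "apath u p v" "x \<in> leaves G" "x \<in> set (awalk_verts u p)"
  shows "x = u \<or> x = v"
proof (rule ccontr)
  assume x: "\<not> (x = u \<or> x = v)"
  obtain q r where qr: "p = q @ r" "awalk u q x" "awalk x r v"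
    using awalk_decomp[OF awalkI_apath[OF assms(1)] assms(3)] by auto
  then obtain f r' where f: "r = f # r'"
    using x by (cases r) (auto simp: awalk_simps)
  obtain q' e where e: "q = q' @ [e]"
    using x qr by (cases q rule: rev_cases) (auto simp: awalk_simps)
  have "snd e = x" "fst f = x"
    using qr(2,3) unfolding e f by (auto simp: awalk_simps)
  then obtain y z where yz: "e = (y, x)" "f = (x, z)"
    by (metis prod.collapse)
  have arcs: "(y, x) \<in> parcs G" "(x, z) \<in> parcs G"
    using qr(2,3) unfolding e f yz by (auto simp: awalk_simps)
  have "distinct (awalk_verts u (q' @ (y, x) # (x, z) # r'))"
    using assms(1) unfolding qr(1) e f yz by (auto simp: apath_def)
  moreover have walk: "awalk u (q' @ (y, x) # (x, z) # r') v"
    using awalkI_apath[OF assms(1)] unfolding qr(1) e f yz by simp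
  then have "z \<in> set (awalk_verts z r')"
    by (auto simp: awalk_simps intro: hd_in_awalk_verts)
  ultimately have "y \<noteq> z"
    using awalk_verts_append2[OF walk] by auto
  then show False
    using assms(2) arcs arcs_symmetric unfolding leaves_def by blast
qed

section \<open>Visibility and the comparison with the leaves\<close>

text \<open>By uniqueness any path is the shortest one, so minimality of the length drops
  out.\<close>

lemma mutually_visible_iff:
  assumes "apath u p v"
  shows "mutually_visible G P u v \<longleftrightarrow> set (awalk_verts u p) \<inter> P \<subseteq> {u, v}"
  using assms apath_unique[of u _ v] unfolding mutually_visible_def shortest_path_def by auto

lemma mutual_visibility_set_leaves: "mutual_visibility_set G (leaves G)"
  unfolding mutual_visibility_set_def
proof (intro conjI ballI impI)
  show "leaves G \<subseteq> pverts G"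
    by (auto simp: leaves_def)
  fix u v assume "u \<in> leaves G" "v \<in> leaves G"
  then obtain p where p: "apath u p v"
    using apath_exists[of u v] by (auto simp: leaves_def)
  then show "mutually_visible G (leaves G) u v"
    using leaf_on_apath mutually_visible_iff by blast
qed

lemma leaf_behind_point:
  assumes P: "mutual_visibility_set G P" and p: "p \<in> P" and "P \<noteq> {p}"
  obtains x where "x \<in> leaves G"
    "\<And>r w. \<lbrakk>r \<in> P; r \<noteq> p; apath r w x\<rbrakk> \<Longrightarrow> p \<in> set (awalk_verts r w)"
proof -
  obtain q where q: "q \<in> P" "q \<noteq> p"
    using p \<open>P \<noteq> {p}\<close> by blast
  have "P \<subseteq> pverts G"
    using P by (simp add: mutual_visibility_set_def)
  then obtain x s where x: "x \<in> leaves G" and s: "apath q s x" "p \<in> set (awalk_verts q s)"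
    using leaf_beyond[of q p] p q by blast
  have "p \<in> set (awalk_verts r w)" if r: "r \<in> P" "r \<noteq> p" and w: "apath r w x" for r w
  proof (rule ccontr)
    assume nw: "p \<notin> set (awalk_verts r w)"
    \<comment> \<open>Since \<open>q\<close> and \<open>r\<close> see each other, the point
      \<open>p\<close>, distinct from both, is not on the path between them.\<close>
    obtain t where t: "apath q t r" "p \<notin> set (awalk_verts q t)"
    proof (cases "r = q")
      case True
      with that[of "[]"] r \<open>P \<subseteq> pverts G\<close> show ?thesis
        by (auto simp: apath_Nil_iff)
    next
      case False
      obtain t where "apath q t r"
        using apath_exists[of q r] q r \<open>P \<subseteq> pverts G\<close> by blast
      moreover have "mutually_visible G P q r"
        using P q r False by (auto simp: mutual_visibility_set_def)
      ultimately show ?thesis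
        using that mutually_visible_iff p q r by auto
    qed
    note tw = awalkI_apath[OF t(1)] awalkI_apath[OF w]
    \<comment> \<open>The detour through \<open>r\<close> gives a path from \<open>q\<close> to
      \<open>x\<close> that misses \<open>p\<close>, whereas the unique such path \<open>s\<close>
      contains \<open>p\<close>.\<close>
    obtain s' where s': "apath q s' x" "set (awalk_verts q s') \<subseteq> set (awalk_verts q (t @ w))"
      using apath_within_awalk[OF awalk_appendI[OF tw]] .
    then have "p \<notin> set (awalk_verts q s')"
      using set_awalk_verts_append[OF tw] nw t(2) by auto
    moreover have "s' = s"
      using s'(1) s(1) by (rule apath_unique)
    ultimately show False
      using s(2) by simp
  qed
  with x show thesis
    by (rule that)
qed

text \<open>A tree with a single vertex has no leaf, although its vertex forms a mutual-visibility
  set; hence the restriction on the number of vertices.\<close>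

lemma card_mutual_visibility_set_le:
  assumes P: "mutual_visibility_set G P" and "card (pverts G) \<noteq> 1"
  shows "card P \<le> card (leaves G)"
proof -
  have PV: "P \<subseteq> pverts G"
    using P by (simp add: mutual_visibility_set_def)
  have fin: "finite (leaves G)"
    using pair_finite_verts by (simp add: leaves_def)
  show ?thesis
  \<comment> \<open>With at most one point there may be no second point from which to look for a
    leaf behind the first; here the existence of one leaf suffices.\<close>
  proof (cases "\<exists>p. P \<subseteq> {p}")
    case True
    then have "card P \<le> 1"
      by (auto dest: subset_singletonD)
    obtain u where u: "u \<in> pverts G"
      using connected_tree by (auto simp: connected_def strongly_connected_def)
    have "pverts G \<noteq> {u}"
      using assms by auto
    then obtain v where "v \<in> pverts G" "u \<noteq> v"
      using u by auto
    then have "leaves G \<noteq> {}"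
      using leaf_beyond[of u v] u by auto
    then have "1 \<le> card (leaves G)"
      using fin by (simp add: Suc_le_eq card_gt_0_iff)
    with \<open>card P \<le> 1\<close> show ?thesis
      by simp
  next
    case False
    then have "\<forall>p\<in>P. \<exists>x. x \<in> leaves G \<and>
        (\<forall>r w. r \<in> P \<longrightarrow> r \<noteq> p \<longrightarrow> apath r w x \<longrightarrow> p \<in> set (awalk_verts r w))"
      using leaf_behind_point[OF P] by (metis subset_refl)
    then obtain f where f: "\<And>p. p \<in> P \<Longrightarrow> f p \<in> leaves G"
      and between: "\<And>p r w. \<lbrakk>p \<in> P; r \<in> P; r \<noteq> p; apath r w (f p)\<rbrakk> \<Longrightarrow> p \<in> set (awalk_verts r w)"
      by metis
    have "inj_on f P"
    proof (rule inj_onI, rule ccontr)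
      fix p q assume pq: "p \<in> P" "q \<in> P" "f p = f q" "p \<noteq> q"
      obtain w where w: "apath q w (f p)"
        using apath_exists[of q "f p"] f[of p] pq PV unfolding leaves_def by blast
      have "p \<in> set (awalk_verts q w)"
        using between w pq by auto
      from awalk_decomp[OF awalkI_apath[OF w] this] obtain w1 w2
        where w12: "w = w1 @ w2" "awalk q w1 p" "awalk p w2 (f p)"
        by auto
      have w2: "apath p w2 (f p)"
        using w w12 by (auto simp: apath_append_iff)
      \<comment> \<open>As \<open>w2\<close> leads to the leaf \<open>f q\<close> too, it passes
        through \<open>q\<close>. But \<open>w\<close> already starts in \<open>q\<close>, before it
        reaches \<open>p\<close>, so it would visit \<open>q\<close> twice.\<close>
      have "q \<in> set (awalk_verts p w2)"
        using between[of q p w2] w2 pq by auto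
      moreover have "q \<in> set (butlast (awalk_verts q w1))"
        using w12(2) pq by (cases w1) (auto simp: awalk_simps)
      moreover have "awalk_verts q w = butlast (awalk_verts q w1) @ awalk_verts p w2"
        using awalk_verts_append2[of q w1 w2] awalkI_apath[OF w] w12 by auto
      ultimately show False
        using w by (auto simp: apath_def)
    qed
    with f fin show ?thesis
      by (metis card_inj_on_le image_subsetI)
  qed
qed

end

theorem corollary4p3:
  fixes T :: "'a pair_pre_digraph"
  assumes "undirected_tree T"
  shows "mutual_visibility_set T (leaves T) \<and>
    (card (pverts T) \<noteq> 1 \<longrightarrow> mutual_visibility_number T = card (leaves T))"
proof -
  interpret pair_tree T
    using assms unfolding undirected_tree_def pair_tree_def pair_tree_axioms_def
    by (auto simp: not_le)
  \<comment> \<open>Finiteness makes \<open>Max\<close> a true maximum; the set of leaves attains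
    the upper bound.\<close>
  have fin: "finite {P. mutual_visibility_set T P}"
    using pair_finite_verts
    by (auto simp: mutual_visibility_set_def intro: finite_subset[of _ "Pow (pverts T)"])
  show ?thesis
    unfolding mutual_visibility_number_def
    using fin mutual_visibility_set_leaves card_mutual_visibility_set_le
    by (auto intro!: Max_eqI)
qed

end
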